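(* Let $A=(a_1\ \cdots\ a_n)$ be a full rank $(d-1)\times n$ integer matrix such that the $d\times n$ matrix obtained from $A$ by appending a row of ones has rank $d$. Let $c_{easy}$ and $c_{stat}$ be scaling vectors in $\mathbb{R}_{>0}^n$. Fix a generic data vector $u$ with positive entries. Let $\hat p_{easy}$ and $\hat p_{stat}$ be the respective maximum likelihood estimates on $V^{c_{easy}}$ and $V^{c_{stat}}$ for the data $u$, and consider the homotopy $$H(\theta,t)=t\cdot F_{easy}(u,\theta)+(1-t)\cdot F_{stat}(u,\theta).$$ Let $\gamma$ denote the path of the homotopy whose start point (at $t=1$) corresponds to $\hat p_{easy}$. Then the endpoint of $\gamma$ (at $t=0$) is (the point corresponding to) $\hat p_{stat}$.
   Context: Scaled toric variety: for $c\in(\mathbb{C}^* )^n$, $\psi^c:(\mathbb{C}^* )^d\to(\mathbb{C}^* )^n$ is $\psi^c(s,\theta_1,\ldots,\theta_{d-1})=(c_1s\theta^{a_1},\ldots,c_ns\theta^{a_n})$, and $V^c\subset\mathbb{P}^{n-1}$ is the projective variety whose affine cone is the Zariski closure of $\psi^c((\mathbb{C}^* )^d)$ in $\mathbb{C}^n$. Likelihood equations for $V^c$ and data $u$: with $u_+=\sum_iu_i$ and $f_c=\sum_{i=1}^nc_i\theta^{a_i}$, these are the $d$ equations $1=sf_c$ and $(Au)_i=u_+s\theta_i\frac{\partial f_c}{\partial\theta_i}$, $i=1,\ldots,d-1$, in the $d$ unknowns $(s,\theta_1,\ldots,\theta_{d-1})$. $F_{easy}(u,\theta)$ is the $d$-tuple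 of differences of left and right sides of these equations with $c=c_{easy}$, and $F_{stat}(u,\theta)$ is the same with $c=c_{stat}$; here $\theta$ abbreviates all $d$ unknowns $(s,\theta_1,\ldots,\theta_{d-1})$. ML estimate: for positive $c$ and $u$, the maximum likelihood estimate on $V^c$ is the unique point $\hat p\in V^c$ with positive coordinates and $\sum_i\hat p_i=1$ that is a critical point of the likelihood function $\ell_u(p)=p_1^{u_1}\cdots p_n^{u_n}/(p_1+\cdots+p_n)^{u_1+\cdots+u_n}$ on $V^c$ (it exists and is unique by Birch's theorem). A parameter point $(s,\theta)$ with positive real coordinates corresponds to $\hat p$ if $\psi^c(s,\theta)=\hat p$. Path: a path of the homotopy is a continuous path of solutions $\theta(t)$ of $H(\theta(t),t)=0$ as $t$ goes from $1$ to $0$ in $[0,1]$. *)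

theory Defs
  imports "HOL-Analysis.Analysis"
begin

definition complex_vec :: "real ^ 'k \<Rightarrow> complex ^ 'k" where
  "complex_vec x = (\<chi> i. of_real (x $ i))"

text \<open>The index \<^term>\<open>None\<close> carries the appended row of ones.\<close>

definition append_ones_row :: "int ^ 'n ^ 'm \<Rightarrow> int ^ 'n ^ ('m option)" where
  "append_ones_row A = (\<chi> k j. case k of None \<Rightarrow> 1 | Some i \<Rightarrow> A $ i $ j)"


text \<open>
  Complex polynomial functions. The library's \<^const>\<open>polynomial_function\<close> only knows real
  structure: on complex vectors it also admits conjugates of coordinates, hence would
  induce the real Zariski topology.
\<close>

inductive complex_polynomial :: "(complex ^ 'n \<Rightarrow> complex) \<Rightarrow> bool" where
  const: "complex_polynomial (\<lambda>_. a)"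
| coord: "complex_polynomial (\<lambda>x. x $ i)"
| add: "complex_polynomial f \<Longrightarrow> complex_polynomial g \<Longrightarrow> complex_polynomial (\<lambda>x. f x + g x)"
| mult: "complex_polynomial f \<Longrightarrow> complex_polynomial g \<Longrightarrow> complex_polynomial (\<lambda>x. f x * g x)"

definition vanishing_ideal :: "(complex ^ 'n) set \<Rightarrow> (complex ^ 'n \<Rightarrow> complex) set" where
  "vanishing_ideal S = {f. complex_polynomial f \<and> (\<forall>x\<in>S. f x = 0)}"

definition zariski_closure :: "(complex ^ 'n) set \<Rightarrow> (complex ^ 'n) set" where
  "zariski_closure S = {x. \<forall>f\<in>vanishing_ideal S. f x = 0}"

definition tangent_space :: "(complex ^ 'n) set \<Rightarrow> complex ^ 'n \<Rightarrow> (complex ^ 'n) set" where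
  "tangent_space X p = {v. \<forall>f\<in>vanishing_ideal X. frechet_derivative f (at p) v = 0}"

definition critical_point_on ::
    "(complex ^ 'n) set \<Rightarrow> (complex ^ 'n \<Rightarrow> complex) \<Rightarrow> complex ^ 'n \<Rightarrow> bool" where
  "critical_point_on X h p \<longleftrightarrow>
     p \<in> X \<and> h differentiable (at p) \<and> (\<forall>v\<in>tangent_space X p. frechet_derivative h (at p) v = 0)"


text \<open>A parameter point is a pair \<open>(s, \<theta>)\<close>.\<close>

type_synonym 'm param = "complex \<times> (complex ^ 'm)"

definition torus :: "('m::finite) param set" where
  "torus = {(s, \<theta>). s \<noteq> 0 \<and> (\<forall>i. \<theta> $ i \<noteq> 0)}"

definition laurent_monomial :: "int ^ 'n ^ 'm \<Rightarrow> 'n \<Rightarrow> complex ^ 'm \<Rightarrow> complex" where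
  "laurent_monomial A j \<theta> = (\<Prod>i\<in>UNIV. \<theta> $ i powi (A $ i $ j))"

definition psi :: "int ^ 'n ^ 'm \<Rightarrow> complex ^ 'n \<Rightarrow> 'm param \<Rightarrow> complex ^ 'n" where
  "psi A c = (\<lambda>(s, \<theta>). \<chi> j. c $ j * s * laurent_monomial A j \<theta>)"

text \<open>
  The scaled toric variety in projective space is represented by its affine cone. A point of it
  whose coordinate sum is nonzero is represented by the vector in the cone with coordinate sum 1.
\<close>

definition toric_cone :: "int ^ 'n ^ 'm \<Rightarrow> complex ^ 'n \<Rightarrow> (complex ^ 'n) set" where
  "toric_cone A c = zariski_closure (psi A c ` torus)"


text \<open>
  For real exponents the likelihood function is multivalued on complex space; the principal
  branch is used, which is holomorphic near vectors with positive coordinates.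
  The function is homogeneous of degree 0, so at such a vector of an affine cone, being critical
  on the cone and being critical on the projective variety are the same. Positive vectors in
  \<^term>\<open>toric_cone A c\<close>, with all entries of \<^term>\<open>c\<close> nonzero, are smooth points of it.
\<close>

definition likelihood :: "real ^ 'n \<Rightarrow> complex ^ 'n \<Rightarrow> complex" where
  "likelihood u p =
     (\<Prod>j\<in>UNIV. p $ j powr of_real (u $ j)) /
     (\<Sum>j\<in>UNIV. p $ j) powr of_real (\<Sum>j\<in>UNIV. u $ j)"

definition is_ml_estimate ::
    "int ^ 'n ^ 'm \<Rightarrow> complex ^ 'n \<Rightarrow> real ^ 'n \<Rightarrow> real ^ 'n \<Rightarrow> bool" where
  "is_ml_estimate A c u p \<longleftrightarrow>
     (\<forall>j. p $ j > 0) \<and> (\<Sum>j\<in>UNIV. p $ j) = 1 \<and>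
     critical_point_on (toric_cone A c) (likelihood u) (complex_vec p)"

definition corresponds ::
    "int ^ 'n ^ 'm \<Rightarrow> complex ^ 'n \<Rightarrow> 'm param \<Rightarrow> real ^ 'n \<Rightarrow> bool" where
  "corresponds A c x p \<longleftrightarrow>
     (\<exists>s \<theta>. s > 0 \<and> (\<forall>i. \<theta> $ i > 0) \<and> x = (of_real s, complex_vec \<theta>)) \<and>
     psi A c x = complex_vec p"


definition toric_poly :: "int ^ 'n ^ 'm \<Rightarrow> complex ^ 'n \<Rightarrow> complex ^ 'm \<Rightarrow> complex" where
  "toric_poly A c \<theta> = (\<Sum>j\<in>UNIV. c $ j * laurent_monomial A j \<theta>)"

definition partial_deriv :: "'m \<Rightarrow> (complex ^ 'm \<Rightarrow> complex) \<Rightarrow> complex ^ 'm \<Rightarrow> complex" where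
  "partial_deriv i f \<theta> = deriv (\<lambda>z. f (\<chi> k. if k = i then z else \<theta> $ k)) (\<theta> $ i)"

definition likelihood_system ::
    "int ^ 'n ^ 'm \<Rightarrow> complex ^ 'n \<Rightarrow> real ^ 'n \<Rightarrow> 'm param \<Rightarrow> complex \<times> (complex ^ 'm)" where
  "likelihood_system A c u = (\<lambda>(s, \<theta>).
     (1 - s * toric_poly A c \<theta>,
      \<chi> i. of_real ((map_matrix real_of_int A *v u) $ i) -
           of_real (\<Sum>j\<in>UNIV. u $ j) * s * \<theta> $ i * partial_deriv i (toric_poly A c) \<theta>))"

definition homotopy_system ::
    "int ^ 'n ^ 'm \<Rightarrow> complex ^ 'n \<Rightarrow> complex ^ 'n \<Rightarrow> real ^ 'n \<Rightarrow>
     'm param \<Rightarrow> real \<Rightarrow> complex \<times> (complex ^ 'm)" where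
  "homotopy_system A c_easy c_stat u x t =
     t *\<^sub>R likelihood_system A c_easy u x + (1 - t) *\<^sub>R likelihood_system A c_stat u x"

definition is_homotopy_path ::
    "int ^ 'n ^ 'm \<Rightarrow> complex ^ 'n \<Rightarrow> complex ^ 'n \<Rightarrow> real ^ 'n \<Rightarrow> (real \<Rightarrow> 'm param) \<Rightarrow> bool" where
  "is_homotopy_path A c_easy c_stat u \<gamma> \<longleftrightarrow>
     continuous_on {0..1} \<gamma> \<and>
     (\<forall>t\<in>{0..1}. \<gamma> t \<in> torus \<and> homotopy_system A c_easy c_stat u (\<gamma> t) t = 0)"


text \<open>
  A property holds for generic data if it holds off the zero set of some nonzero polynomial.
  Since the data are real, a real polynomial suffices: the real zeros of a complex
  polynomial are those of the sum of the squares of its real and imaginary parts.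
\<close>

definition holds_generically :: "(real ^ 'n \<Rightarrow> bool) \<Rightarrow> bool" where
  "holds_generically P \<longleftrightarrow>
     (\<exists>G. real_polynomial_function G \<and> (\<exists>u. G u \<noteq> 0) \<and> (\<forall>u. G u \<noteq> 0 \<longrightarrow> P u))"

end

theory Submission
  imports Defs
begin

text \<open>
  The systems are affine in the scaling vector, so the homotopy at time \<open>t\<close> is the likelihood
  system for the positive scaling \<open>t c_easy + (1 - t) c_stat\<close>. In logarithmic coordinates its
  positive solutions are the critical points of a strictly convex coercive function; hence there is
  exactly one for every \<open>t\<close>, and these stay in a compact set and depend continuously on \<open>t\<close>. Among
  all complex solutions a positive one is isolated, so no other path can branch off. At
  \<open>t = 1\<close> and \<open>t = 0\<close> the positive solutions are the maximum likelihood estimates: the binomials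
  vanishing on the cone force a positive point of the cone to be parametrised by positive
  parameters, and differentiating the likelihood along one-parameter curves in the torus gives the
  likelihood equations.
\<close>

section \<open>Critical points of weighted exponential sums\<close>

text \<open>Coercivity of one summand of the convex function minimised later. For positive
  \<open>z\<close> the quadratic Taylor term beats the linear one up to a constant.\<close>

lemma exp_minus_linear_ge:
  fixes c q z :: real
  assumes "c > 0" "q > 0"
  shows "q * \<bar>z\<bar> - 2 * q\<^sup>2 / c \<le> c * exp z - q * z"
proof (cases "z \<le> 0")
  case True
  have "0 \<le> 2 * q\<^sup>2 / c" "0 \<le> c * exp z" using assms by simp_all
  then show ?thesis using True by simp
next
  case False
  have "exp z \<ge> 1 + z + z\<^sup>2 / 2"
    using False by (intro exp_lower_Taylor_quadratic) simp
  then have "exp z \<ge> z\<^sup>2 / 2" using False by linarith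
  then have "c * (z\<^sup>2 / 2) \<le> c * exp z" using assms by (intro mult_left_mono) auto
  \<comment> \<open>Completing the square against slope \<open>2 * q\<close>, one \<open>q\<close>
    for the subtracted term and one for the claimed growth, yields the constant
    \<open>2 * q\<^sup>2 / c\<close>.\<close>
  moreover have "c * (z\<^sup>2 / 2) - 2 * q * z + 2 * q\<^sup>2 / c = c / 2 * (z - 2 * q / c)\<^sup>2"
    using assms by (simp add: power2_eq_square field_simps)
  moreover have "\<dots> \<ge> 0" using assms by simp
  ultimately show ?thesis using False by simp
qed

lemma exp_monotone_pairing:
  fixes z w :: real
  shows "0 \<le> (exp z - exp w) * (z - w)"
  by (cases "z \<le> w") (auto intro: mult_nonneg_nonneg mult_nonpos_nonpos)

text \<open>The remainder \<open>exp w - 1 - w\<close> is smaller than \<open>norm w\<close>, so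
  \<open>w * cnj w\<close> dominates. A local complex counterpart of
  \<open>exp_monotone_pairing\<close>.\<close>

lemma Re_exp_pairing_pos:
  fixes w :: complex
  assumes "norm w < 1/4" "w \<noteq> 0"
  shows "Re ((exp w - 1) * cnj w) > 0"
proof -
  define r where "r = exp w - 1 - w"
  have "norm (exp w - (\<Sum>k\<le>1. w ^ k / fact k)) \<le> exp \<bar>Re w\<bar> * norm w ^ Suc 1 / fact 1"
    by (rule Taylor_exp)
  then have "norm r \<le> exp \<bar>Re w\<bar> * (norm w)\<^sup>2"
    by (simp add: r_def diff_diff_eq power2_eq_square)
  also have "exp \<bar>Re w\<bar> \<le> 2"
  proof -
    have "\<bar>Re w\<bar> \<le> 1/2" using assms abs_Re_le_cmod[of w] by linarith
    then have "norm (exp \<bar>Re w\<bar>) \<le> 1 + 2 * norm \<bar>Re w\<bar>"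
      by (intro exp_bound_lemma) simp
    then show ?thesis using \<open>\<bar>Re w\<bar> \<le> 1/2\<close> by simp
  qed
  finally have "norm r \<le> 2 * (norm w)\<^sup>2" by (simp add: mult_right_mono)
  also have "\<dots> = (2 * norm w) * norm w" by (simp add: power2_eq_square)
  also have "\<dots> < 1 * norm w" using assms by (intro mult_strict_right_mono) auto
  finally have r: "norm r < norm w" by simp
  have "- Re (r * cnj w) \<le> norm (r * cnj w)" using abs_Re_le_cmod[of "r * cnj w"] by linarith
  also have "\<dots> = norm r * norm w" by (simp add: norm_mult)
  also have "\<dots> < norm w * norm w" using r assms by (intro mult_strict_right_mono) auto
  finally have "0 < norm w * norm w + Re (r * cnj w)" by simp
  also have "norm w * norm w = Re (w * cnj w)"
    by (metis cmod_power2 complex_mult_cnj Re_complex_of_real power2_eq_square)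
  finally show ?thesis by (simp add: r_def algebra_simps)
qed

text \<open>
  Pairing the equation with the conjugate of the displacement replaces the implicit function
  theorem: the complex solutions near a positive one are isolated, with an explicit radius.
\<close>

lemma complex_exp_pairing_eq_0:
  fixes w :: "'n::finite \<Rightarrow> complex" and p :: "'n \<Rightarrow> real"
  assumes p: "\<And>j. p j > 0" and w: "\<And>j. norm (w j) < 1/4"
    and eq: "(\<Sum>j\<in>UNIV. of_real (p j) * (exp (w j) - 1) * cnj (w j)) = 0"
  shows "w j = 0"
proof -
  have nn: "p j * Re ((exp (w j) - 1) * cnj (w j)) \<ge> 0" for j
    using Re_exp_pairing_pos[OF w, of j] p[of j]
    by (cases "w j = 0") (auto intro!: mult_nonneg_nonneg simp: less_imp_le)
  have "(\<Sum>j\<in>UNIV. p j * Re ((exp (w j) - 1) * cnj (w j))) =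
    Re (\<Sum>j\<in>UNIV. of_real (p j) * (exp (w j) - 1) * cnj (w j))"
    by (simp add: mult.assoc algebra_simps)
  also have "\<dots> = 0" by (simp add: eq)
  finally have "p j * Re ((exp (w j) - 1) * cnj (w j)) = 0"
    using nn by (subst (asm) sum_nonneg_eq_0_iff) auto
  then show ?thesis using Re_exp_pairing_pos[OF w, of j] p[of j] by fastforce
qed

text \<open>Stationarity of the sum of \<open>c j * exp (L j y) - q j * L j y\<close>, tested in
  every direction \<open>y'\<close> so that later proofs may choose the direction.\<close>

definition exp_critical :: "('n::finite \<Rightarrow> 'v \<Rightarrow> real) \<Rightarrow> ('n \<Rightarrow> real) \<Rightarrow> ('n \<Rightarrow> real) \<Rightarrow> 'v \<Rightarrow> bool" where
  "exp_critical L q c y \<longleftrightarrow> (\<forall>y'. (\<Sum>j\<in>UNIV. (c j * exp (L j y) - q j) * L j y') = 0)"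

text \<open>Joint injectivity of the forms is what makes that sum strictly convex and coercive for
  positive weights.\<close>

locale linear_forms =
  fixes L :: "'n::finite \<Rightarrow> 'v::euclidean_space \<Rightarrow> real"
  assumes linear: "\<And>j. linear (L j)"
    and separating: "\<And>y. (\<And>j. L j y = 0) \<Longrightarrow> y = 0"
begin

lemma continuous_on_form [continuous_intros]:
  "continuous_on S f \<Longrightarrow> continuous_on S (\<lambda>x. L j (f x))"
  using bounded_linear.continuous_on[OF linear[unfolded linear_conv_bounded_linear]] .

text \<open>An injective linear map is bounded below, so the weighted absolute values of the forms
  control the norm.\<close>

lemma compact_sublevel:
  assumes q: "\<And>j. q j > 0"
  shows "compact {y. (\<Sum>j\<in>UNIV. q j * \<bar>L j y\<bar>) \<le> R}"
proof -
  define f where "f = (\<lambda>y. \<chi> j. q j * L j y)"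
  have lin: "linear f"
    unfolding f_def by (rule linearI)
      (simp_all add: vec_eq_iff linear_add[OF linear] linear_cmul[OF linear] algebra_simps)
  have "inj f"
    unfolding linear_injective_0[OF lin]
    using separating q by (auto simp: f_def vec_eq_iff less_le)
  from linear_inj_bounded_below_pos[OF lin this] obtain B where
    B: "B > 0" "\<And>x. B * norm x \<le> norm (f x)" by metis
  have "norm y \<le> R / B" if "(\<Sum>j\<in>UNIV. q j * \<bar>L j y\<bar>) \<le> R" for y
  proof -
    have "B * norm y \<le> (\<Sum>j\<in>UNIV. \<bar>f y $ j\<bar>)"
      using B(2)[of y] norm_le_l1_cart[of "f y"] by linarith
    also have "\<dots> = (\<Sum>j\<in>UNIV. q j * \<bar>L j y\<bar>)"
      using q by (simp add: f_def abs_mult less_imp_le)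
    finally show ?thesis using that B(1) by (simp add: field_simps)
  qed
  then have "bounded {y. (\<Sum>j\<in>UNIV. q j * \<bar>L j y\<bar>) \<le> R}"
    by (auto simp: bounded_iff)
  moreover have "closed {y. (\<Sum>j\<in>UNIV. q j * \<bar>L j y\<bar>) \<le> R}"
    by (intro closed_Collect_le continuous_intros)
  ultimately show ?thesis by (simp add: compact_eq_bounded_closed)
qed

text \<open>Critical points are found by minimising the sum of the functions \<open>c j * exp z - q j * z\<close>.\<close>

lemma exp_critical_exists:
  assumes c: "\<And>j. c j > 0" and q: "\<And>j. q j > 0"
  shows "\<exists>y. exp_critical L q c y \<and>
    (\<Sum>j\<in>UNIV. q j * \<bar>L j y\<bar>) \<le> (\<Sum>j\<in>UNIV. c j + 2 * (q j)\<^sup>2 / c j)"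
proof -
  define \<Phi> where "\<Phi> y = (\<Sum>j\<in>UNIV. c j * exp (L j y) - q j * L j y)" for y
  \<comment> \<open>\<open>R\<close> is \<open>\<Phi> 0\<close> plus the loss in
    \<open>lower\<close>. Outside \<open>K\<close> the function thus exceeds
    \<open>\<Phi> 0\<close>, and a minimum on \<open>K\<close> is global.\<close>
  define R where "R = (\<Sum>j\<in>UNIV. c j + 2 * (q j)\<^sup>2 / c j)"
  define K where "K = {y. (\<Sum>j\<in>UNIV. q j * \<bar>L j y\<bar>) \<le> R}"
  have L0: "L j 0 = 0" for j using linear_0[OF linear] .
  have lower: "(\<Sum>j\<in>UNIV. q j * \<bar>L j y\<bar>) - (\<Sum>j\<in>UNIV. 2 * (q j)\<^sup>2 / c j) \<le> \<Phi> y" for y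
    unfolding \<Phi>_def sum_subtractf[symmetric]
    by (rule sum_mono) (use exp_minus_linear_ge c q in blast)
  have \<Phi>0: "\<Phi> 0 = (\<Sum>j\<in>UNIV. c j)" by (simp add: \<Phi>_def L0)
  have "R \<ge> 0" unfolding R_def using c by (intro sum_nonneg) (simp add: less_imp_le)
  then have "0 \<in> K" by (simp add: K_def L0)
  have "compact K" unfolding K_def by (rule compact_sublevel[OF q])
  moreover have "continuous_on K \<Phi>" unfolding \<Phi>_def by (intro continuous_intros)
  ultimately obtain y where y: "y \<in> K" "\<And>x. x \<in> K \<Longrightarrow> \<Phi> y \<le> \<Phi> x"
    using continuous_attains_inf \<open>0 \<in> K\<close> by (metis empty_iff)
  have min: "\<Phi> y \<le> \<Phi> x" for x
  proof (cases "x \<in> K")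
    case False
    then have "\<Phi> 0 \<le> \<Phi> x" using lower[of x] \<Phi>0 by (simp add: K_def R_def sum.distrib)
    then show ?thesis using y(2)[OF \<open>0 \<in> K\<close>] by linarith
  qed (use y in auto)
  have "(\<Sum>j\<in>UNIV. (c j * exp (L j y) - q j) * L j y') = 0" for y'
  proof -
    have L: "L j (y + t *\<^sub>R y') = L j y + t * L j y'" for j t
      by (simp add: linear_add[OF linear] linear_cmul[OF linear])
    have "((\<lambda>t. \<Phi> (y + t *\<^sub>R y')) has_real_derivative
        (\<Sum>j\<in>UNIV. (c j * exp (L j y) - q j) * L j y')) (at 0)"
      unfolding \<Phi>_def L
      by (auto intro!: derivative_eq_intros simp: algebra_simps)
    then show ?thesis
      by (rule DERIV_local_min[where d = 1]) (use min in auto)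
  qed
  then show ?thesis using y(1) by (auto simp: exp_critical_def K_def R_def)
qed

text \<open>Subtracting the two equations in direction \<open>y - z\<close> cancels \<open>q\<close>
  and leaves a sum of terms that are nonnegative because \<open>exp\<close> is increasing.\<close>

lemma exp_critical_unique:
  assumes c: "\<And>j. c j > 0" and y: "exp_critical L q c y" and z: "exp_critical L q c z"
  shows "y = z"
proof -
  have "(\<Sum>j\<in>UNIV. (c j * exp (L j y) - q j) * L j (y - z)) -
      (\<Sum>j\<in>UNIV. (c j * exp (L j z) - q j) * L j (y - z)) = 0"
    using y z by (simp add: exp_critical_def)
  then have "(\<Sum>j\<in>UNIV. c j * ((exp (L j y) - exp (L j z)) * (L j y - L j z))) = 0"
    by (simp add: sum_subtractf[symmetric] linear_diff[OF linear] algebra_simps)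
  moreover have "0 \<le> c j * ((exp (L j y) - exp (L j z)) * (L j y - L j z))" for j
    using exp_monotone_pairing less_imp_le[OF c] by (rule mult_nonneg_nonneg[rotated])
  ultimately have eq: "c j * ((exp (L j y) - exp (L j z)) * (L j y - L j z)) = 0" for j
    by (subst (asm) sum_nonneg_eq_0_iff) auto
  have "L j (y - z) = 0" for j
    using c[of j] eq[of j] by (auto simp: linear_diff[OF linear])
  then show ?thesis using separating[of "y - z"] by simp
qed

text \<open>Continuity comes from the closed graph criterion: the a priori bound \<open>R\<close> is
  bounded on the interval, so all critical points lie in one compact set.\<close>

lemma exp_critical_path:
  assumes c: "\<And>t j. t \<in> {0..1} \<Longrightarrow> c t j > 0" and q: "\<And>j. q j > 0"
    and cont: "\<And>j. continuous_on {0..1::real} (\<lambda>t. c t j)"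
  obtains y where "continuous_on {0..1} y" "\<And>t. t \<in> {0..1} \<Longrightarrow> exp_critical L q (c t) (y t)"
proof -
  define R where "R t = (\<Sum>j\<in>UNIV. c t j + 2 * (q j)\<^sup>2 / c t j)" for t
  define y where "y t = (SOME y. exp_critical L q (c t) y \<and> (\<Sum>j\<in>UNIV. q j * \<bar>L j y\<bar>) \<le> R t)" for t
  have y: "exp_critical L q (c t) (y t) \<and> (\<Sum>j\<in>UNIV. q j * \<bar>L j (y t)\<bar>) \<le> R t"
    if "t \<in> {0..1}" for t
    unfolding y_def R_def by (rule someI_ex, rule exp_critical_exists) (use c q that in auto)
  have "continuous_on {0..1} R"
    unfolding R_def using c by (intro continuous_intros cont) (auto simp: less_le)
  then have "compact (R ` {0..1})" by (rule compact_continuous_image) simp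
  then have "bdd_above (R ` {0..1})" by (simp add: bounded_imp_bdd_above compact_imp_bounded)
  then obtain M where M: "\<And>t. t \<in> {0..1} \<Longrightarrow> R t \<le> M"
    unfolding bdd_above_def by blast
  define K where "K = {y. (\<Sum>j\<in>UNIV. q j * \<bar>L j y\<bar>) \<le> M}"
  have "compact K" unfolding K_def by (rule compact_sublevel[OF q])
  have yK: "y t \<in> K" if "t \<in> {0..1}" for t
    using y[OF that] M[OF that] by (auto simp: K_def)
  \<comment> \<open>By uniqueness the graph is the whole solution set over \<open>K\<close>, which
    continuous equations cut out.\<close>
  have "(\<lambda>t. (t, y t)) ` {0..1} =
      {x \<in> {0..1} \<times> K. \<forall>y'. (\<Sum>j\<in>UNIV. (c (fst x) j * exp (L j (snd x)) - q j) * L j y') = 0}"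
    (is "?G = ?H")
  proof
    show "?G \<subseteq> ?H" using y yK by (auto simp: exp_critical_def)
    show "?H \<subseteq> ?G"
    proof
      fix x assume "x \<in> ?H"
      then have x: "fst x \<in> {0..1}" "exp_critical L q (c (fst x)) (snd x)"
        by (auto simp: exp_critical_def)
      then have "snd x = y (fst x)" using exp_critical_unique c y by blast
      then show "x \<in> ?G" using x(1) by (cases x) auto
    qed
  qed
  moreover have "closed ?H"
  proof -
    have "continuous_on ({0..1} \<times> K) (\<lambda>x. c (fst x) j)" for j
      by (rule continuous_on_compose2[OF cont]) (auto intro: continuous_intros)
    then have "continuous_on ({0..1} \<times> K)
        (\<lambda>x. \<Sum>j\<in>UNIV. (c (fst x) j * exp (L j (snd x)) - q j) * L j y')" for y'
      by (intro continuous_intros)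
    then have "closed {x \<in> {0..1} \<times> K. (\<Sum>j\<in>UNIV. (c (fst x) j * exp (L j (snd x)) - q j) * L j y') = 0}" for y'
      using \<open>compact K\<close> by (intro continuous_closed_preimage_constant closed_Times) (auto simp: compact_imp_closed)
    then have "closed (\<Inter>y'. {x \<in> {0..1} \<times> K. (\<Sum>j\<in>UNIV. (c (fst x) j * exp (L j (snd x)) - q j) * L j y') = 0})"
      by (intro closed_INT) auto
    moreover have "?H = (\<Inter>y'. {x \<in> {0..1} \<times> K. (\<Sum>j\<in>UNIV. (c (fst x) j * exp (L j (snd x)) - q j) * L j y') = 0})"
      by auto
    ultimately show ?thesis by simp
  qed
  ultimately have "closed ?G" by simp
  then have "continuous_on {0..1} y"
    using \<open>compact K\<close> yK by (intro continuous_from_closed_graph[of K]) auto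
  then show ?thesis using that y by blast
qed

end

section \<open>Likelihood equations in logarithmic coordinates\<close>

text \<open>
  In logarithmic coordinates \<open>y = (log s, log \<theta>)\<close> the monomial in \<open>s, \<theta>\<close> attached to
  column \<open>j\<close> is the exponential of the linear form \<open>exponent_form A j y\<close>.
\<close>

definition exponent_form :: "int ^ 'n ^ 'm \<Rightarrow> 'n \<Rightarrow> 'a::comm_ring_1 \<times> ('a ^ 'm) \<Rightarrow> 'a" where
  "exponent_form A j y = fst y + (\<Sum>i\<in>UNIV. of_int (A $ i $ j) * snd y $ i)"

text \<open>Its range is the whole torus; composed with \<open>complex_pair\<close> it reaches
  exactly the points with positive coordinates.\<close>

definition exp_point :: "'m::finite param \<Rightarrow> 'm param" where
  "exp_point y = (exp (fst y), \<chi> i. exp (snd y $ i))"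

definition complex_pair :: "real \<times> (real ^ 'm) \<Rightarrow> 'm::finite param" where
  "complex_pair y = (of_real (fst y), complex_vec (snd y))"

lemma exponent_form_complex_pair:
  "exponent_form A j (complex_pair y) = of_real (exponent_form A j y)"
  by (simp add: exponent_form_def complex_pair_def complex_vec_def)

lemma exponent_form_add: "exponent_form A j (x + y) = exponent_form A j x + exponent_form A j y"
  by (simp add: exponent_form_def algebra_simps sum.distrib)

lemma exponent_form_diff: "exponent_form A j (x - y) = exponent_form A j x - exponent_form A j y"
  by (simp add: exponent_form_def algebra_simps sum_subtractf)

lemma exponent_form_cnj:
  "cnj (exponent_form A j y) = exponent_form A j (cnj (fst y), \<chi> i. cnj (snd y $ i))"
  by (simp add: exponent_form_def)

lemma linear_exponent_form: "linear (exponent_form A j :: real \<times> (real ^ 'm) \<Rightarrow> real)"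
  by (rule linearI) (simp_all add: exponent_form_def algebra_simps sum.distrib sum_distrib_left)

lemma exponent_form_transpose:
  fixes A :: "int ^ 'n ^ 'm" and z :: "real ^ 'm option"
  shows "(transpose (map_matrix real_of_int (append_ones_row A)) *v z) $ j =
    exponent_form A j (z $ None, \<chi> i. z $ Some i)"
  by (simp add: exponent_form_def matrix_vector_mult_def transpose_def map_matrix_def
        append_ones_row_def UNIV_option_conv sum.reindex)

lemma sum_mult_exponent_form:
  "(\<Sum>j\<in>UNIV. r j * exponent_form A j y) =
     (\<Sum>j\<in>UNIV. r j) * fst y + (\<Sum>i\<in>UNIV. (\<Sum>j\<in>UNIV. r j * of_int (A $ i $ j)) * snd y $ i)"
proof -
  have "(\<Sum>j\<in>UNIV. r j * (\<Sum>i\<in>UNIV. of_int (A $ i $ j) * snd y $ i)) =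
      (\<Sum>i\<in>UNIV. (\<Sum>j\<in>UNIV. r j * of_int (A $ i $ j)) * snd y $ i)"
    unfolding sum_distrib_left sum_distrib_right by (subst sum.swap) (simp add: mult.assoc)
  then show ?thesis by (simp add: exponent_form_def distrib_left sum.distrib sum_distrib_right)
qed

text \<open>Testing on unit vectors suffices. The coefficient conditions have the shape of the
  likelihood equations and pass between real and complex scalars.\<close>

lemma exponent_form_orthogonal_iff:
  "(\<forall>y. (\<Sum>j\<in>UNIV. r j * exponent_form A j y) = 0) \<longleftrightarrow>
     (\<Sum>j\<in>UNIV. r j) = 0 \<and> (\<forall>i. (\<Sum>j\<in>UNIV. r j * of_int (A $ i $ j)) = 0)"
  (is "?L \<longleftrightarrow> ?R")
proof
  assume L: ?L
  have "(\<Sum>j\<in>UNIV. r j) = 0"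
    using L[rule_format, of "(1, 0)"] by (simp add: sum_mult_exponent_form)
  moreover have "(\<Sum>j\<in>UNIV. r j * of_int (A $ i $ j)) = 0" for i
    using L[rule_format, of "(0, axis i 1)"]
    by (simp add: sum_mult_exponent_form axis_def if_distrib cong: if_cong)
  ultimately show ?R by blast
qed (simp add: sum_mult_exponent_form)

text \<open>The rank hypothesis makes the transposed augmented matrix injective, and its rows are
  the exponent forms.\<close>

lemma linear_forms_exponent_form:
  fixes A :: "int ^ 'n ^ 'm"
  assumes "rank (map_matrix real_of_int (append_ones_row A)) = CARD('m) + 1"
  shows "linear_forms (exponent_form A :: 'n \<Rightarrow> real \<times> (real ^ 'm) \<Rightarrow> real)"
proof (rule linear_forms.intro)
  fix y :: "real \<times> (real ^ 'm)"
  assume y: "\<And>j. exponent_form A j y = 0"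
  define B where "B = transpose (map_matrix real_of_int (append_ones_row A))"
  define z :: "real ^ 'm option" where "z = (\<chi> k. case k of None \<Rightarrow> fst y | Some i \<Rightarrow> snd y $ i)"
  have "rank B = CARD('m option)" using assms by (simp add: B_def rank_transpose)
  then have "inj ((*v) B)" using full_rank_injective by blast
  moreover have "(B *v z) $ j = 0" for j
    unfolding B_def exponent_form_transpose using y by (simp add: z_def)
  then have "B *v z = B *v 0" by (simp add: vec_eq_iff)
  ultimately have "z = 0" by (rule injD)
  then have "fst y = 0" "snd y $ i = 0" for i
    by (auto simp: z_def vec_eq_iff dest: spec[of _ None] spec[of _ "Some i"])
  then show "y = 0" by (simp add: prod_eq_iff vec_eq_iff)
qed (rule linear_exponent_form)

text \<open>The coefficients are real, so the real case applies to the real and imaginary parts of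
  \<open>y\<close> separately.\<close>

lemma complex_exponent_form_separating:
  fixes A :: "int ^ 'n ^ 'm" and y :: "'m param"
  assumes "rank (map_matrix real_of_int (append_ones_row A)) = CARD('m) + 1"
    and y: "\<And>j. exponent_form A j y = 0"
  shows "y = 0"
proof -
  interpret linear_forms "exponent_form A :: 'n \<Rightarrow> real \<times> (real ^ 'm) \<Rightarrow> real"
    by (rule linear_forms_exponent_form) fact
  have "exponent_form A j (Re (fst y), \<chi> i. Re (snd y $ i)) = Re (exponent_form A j y)"
    "exponent_form A j (Im (fst y), \<chi> i. Im (snd y $ i)) = Im (exponent_form A j y)" for j
    by (simp_all add: exponent_form_def)
  then have "(Re (fst y), \<chi> i. Re (snd y $ i)) = 0" "(Im (fst y), \<chi> i. Im (snd y $ i)) = 0"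
    using y by (auto intro: separating)
  then show ?thesis by (auto simp: prod_eq_iff vec_eq_iff complex_eq_iff)
qed

section \<open>The likelihood equations on the torus\<close>

lemma exp_point_in_torus: "exp_point y \<in> torus"
  by (simp add: exp_point_def torus_def)

lemma exp_point_Ln:
  assumes "x \<in> torus"
  shows "exp_point (Ln (fst x), \<chi> i. Ln (snd x $ i)) = x"
  using assms by (auto simp: exp_point_def torus_def vec_eq_iff)

lemma laurent_monomial_exp:
  "exp l * laurent_monomial A j (\<chi> i. exp (x $ i)) = exp (exponent_form A j (l, x))"
  by (simp add: laurent_monomial_def exponent_form_def exp_add exp_sum exp_power_int)

lemma psi_exp_point: "psi A c (exp_point y) $ j = c $ j * exp (exponent_form A j y)"
  using laurent_monomial_exp[of "fst y" A j "snd y"]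
  by (simp add: psi_def exp_point_def mult.assoc)

text \<open>The Euler operator multiplies each Laurent monomial by its exponent.\<close>

lemma partial_deriv_toric_poly:
  assumes "\<theta> $ i \<noteq> 0"
  shows "\<theta> $ i * partial_deriv i (toric_poly A c) \<theta> =
    (\<Sum>j\<in>UNIV. of_int (A $ i $ j) * (c $ j * laurent_monomial A j \<theta>))"
proof -
  define R where "R j = (\<Prod>k\<in>UNIV - {i}. \<theta> $ k powi (A $ k $ j))" for j
  have split: "laurent_monomial A j (\<chi> k. if k = i then z else \<theta> $ k) = z powi (A $ i $ j) * R j"
    for j z
    unfolding laurent_monomial_def R_def by (subst prod.remove[of _ i]) auto
  have split': "laurent_monomial A j \<theta> = \<theta> $ i powi (A $ i $ j) * R j" for j
    unfolding laurent_monomial_def R_def by (subst prod.remove[of _ i]) auto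
  have "((\<lambda>z. toric_poly A c (\<chi> k. if k = i then z else \<theta> $ k)) has_field_derivative
      (\<Sum>j\<in>UNIV. c $ j * (of_int (A $ i $ j) * (\<theta> $ i) powi (A $ i $ j - 1) * R j))) (at (\<theta> $ i))"
    unfolding toric_poly_def split using assms by (auto intro!: derivative_eq_intros sum.cong)
  then have "\<theta> $ i * partial_deriv i (toric_poly A c) \<theta> =
      (\<Sum>j\<in>UNIV. of_int (A $ i $ j) * (c $ j * (((\<theta> $ i) powi (A $ i $ j - 1) * \<theta> $ i) * R j)))"
    unfolding partial_deriv_def by (simp add: DERIV_imp_deriv sum_distrib_left mult_ac)
  then show ?thesis using assms by (simp add: split' power_int_minus_mult)
qed

text \<open>On the torus the unknowns enter only through \<open>psi A c x\<close>, in which the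
  system is affine; hence it is affine in \<open>c\<close> too.\<close>

lemma likelihood_system_torus:
  assumes "x \<in> torus"
  shows "likelihood_system A c u x =
    (1 - (\<Sum>j\<in>UNIV. psi A c x $ j),
     \<chi> i. (\<Sum>j\<in>UNIV. of_int (A $ i $ j) * of_real (u $ j)) -
          of_real (\<Sum>j\<in>UNIV. u $ j) * (\<Sum>j\<in>UNIV. of_int (A $ i $ j) * psi A c x $ j))"
proof -
  obtain s \<theta> where x: "x = (s, \<theta>)" by force
  have nz: "\<theta> $ i \<noteq> 0" for i using assms by (simp add: x torus_def)
  have "s * (\<theta> $ i * partial_deriv i (toric_poly A c) \<theta>) =
      (\<Sum>j\<in>UNIV. of_int (A $ i $ j) * psi A c x $ j)" for i
    unfolding partial_deriv_toric_poly[OF nz]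
    by (simp add: x psi_def sum_distrib_left mult_ac)
  moreover have "s * toric_poly A c \<theta> = (\<Sum>j\<in>UNIV. psi A c x $ j)"
    by (simp add: x psi_def toric_poly_def sum_distrib_left mult_ac)
  ultimately show ?thesis
    by (simp add: likelihood_system_def x vec_eq_iff matrix_vector_mult_def map_matrix_def mult.assoc)
qed

text \<open>Normalising the data to total 1 turns all equations into orthogonality of a single
  residual vector to the exponent forms.\<close>

lemma likelihood_system_eq_0_iff:
  assumes x: "x \<in> torus" and u: "(\<Sum>j\<in>UNIV. u $ j) \<noteq> 0"
  shows "likelihood_system A c u x = 0 \<longleftrightarrow>
    (\<forall>y. (\<Sum>j\<in>UNIV. (psi A c x $ j - of_real (u $ j / (\<Sum>j\<in>UNIV. u $ j))) * exponent_form A j y) = 0)"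
proof -
  define U where "U = (\<Sum>j\<in>UNIV. u $ j)"
  have U: "U \<noteq> 0" using u by (simp add: U_def)
  define q where "q j = u $ j / U" for j
  have u_eq: "u $ j = U * q j" for j using U by (simp add: q_def)
  have "(\<Sum>j\<in>UNIV. q j) = 1"
    unfolding q_def sum_divide_distrib[symmetric] U_def[symmetric] using U by simp
  then have "(\<Sum>j\<in>UNIV. complex_of_real (q j)) = 1" by (metis of_real_1 of_real_sum)
  then have 1: "(\<Sum>j\<in>UNIV. psi A c x $ j - of_real (q j)) = (\<Sum>j\<in>UNIV. psi A c x $ j) - 1"
    by (simp only: sum_subtractf)
  have eq: "of_real U * (\<Sum>j\<in>UNIV. (psi A c x $ j - of_real (q j)) * of_int (A $ i $ j)) =
      of_real U * (\<Sum>j\<in>UNIV. of_int (A $ i $ j) * psi A c x $ j) -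
      (\<Sum>j\<in>UNIV. of_int (A $ i $ j) * of_real (u $ j))" for i
    unfolding sum_distrib_left sum_subtractf[symmetric] u_eq
    by (intro sum.cong) (simp_all add: algebra_simps)
  have 2: "(\<Sum>j\<in>UNIV. (psi A c x $ j - of_real (q j)) * of_int (A $ i $ j)) = 0 \<longleftrightarrow>
      of_real U * (\<Sum>j\<in>UNIV. of_int (A $ i $ j) * psi A c x $ j) -
      (\<Sum>j\<in>UNIV. of_int (A $ i $ j) * of_real (u $ j)) = 0" for i
    unfolding eq[symmetric] using U by (simp only: mult_eq_0_iff of_real_eq_0_iff simp_thms)
  have "likelihood_system A c u x = 0 \<longleftrightarrow> (\<Sum>j\<in>UNIV. psi A c x $ j) - 1 = 0 \<and>
      (\<forall>i. of_real U * (\<Sum>j\<in>UNIV. of_int (A $ i $ j) * psi A c x $ j) -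
        (\<Sum>j\<in>UNIV. of_int (A $ i $ j) * of_real (u $ j)) = 0)"
    unfolding likelihood_system_torus[OF x] prod_eq_iff vec_eq_iff U_def[symmetric]
      fst_conv snd_conv fst_zero snd_zero vec_lambda_beta zero_index
    by (intro arg_cong2[of _ _ _ _ "(\<and>)"] all_cong1) (auto simp only: right_minus_eq)
  then show ?thesis
    unfolding exponent_form_orthogonal_iff U_def[symmetric] q_def[symmetric] 1 2 .
qed

text \<open>\<open>psi\<close> is linear in the scaling, and the weights \<open>t\<close> and
  \<open>1 - t\<close> add up to 1, so the constant terms of the system are unchanged.\<close>

lemma homotopy_system_torus:
  assumes "x \<in> torus"
  shows "homotopy_system A (complex_vec c) (complex_vec c') u x t =
    likelihood_system A (complex_vec (t *\<^sub>R c + (1 - t) *\<^sub>R c')) u x"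
proof -
  have psi: "psi A (complex_vec (t *\<^sub>R c + (1 - t) *\<^sub>R c')) x $ j =
      t *\<^sub>R psi A (complex_vec c) x $ j + (1 - t) *\<^sub>R psi A (complex_vec c') x $ j" for j
    by (cases x) (simp add: psi_def complex_vec_def scaleR_conv_of_real[where 'a = complex] algebra_simps)
  have sum: "(\<Sum>j\<in>UNIV. r j * psi A (complex_vec (t *\<^sub>R c + (1 - t) *\<^sub>R c')) x $ j) =
      of_real t * (\<Sum>j\<in>UNIV. r j * psi A (complex_vec c) x $ j) +
      (1 - of_real t) * (\<Sum>j\<in>UNIV. r j * psi A (complex_vec c') x $ j)" for r
    unfolding psi sum_distrib_left sum.distrib[symmetric]
    by (intro sum.cong) (simp_all add: scaleR_conv_of_real algebra_simps)
  show ?thesis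
    unfolding homotopy_system_def likelihood_system_torus[OF assms] sum sum[of "\<lambda>_. 1", simplified]
    by (simp add: prod_eq_iff vec_eq_iff scaleR_conv_of_real[where 'a = complex] algebra_simps)
qed

section \<open>Integer kernels and row spaces\<close>

text \<open>
  A simultaneous Dirichlet approximation of a real kernel vector is so close to it that its integer
  image under the matrix must vanish.
\<close>

lemma integer_kernel_dense:
  fixes B :: "int ^ 'n ^ 'k" and v w :: "real ^ 'n"
  assumes w: "\<And>z :: int ^ 'n. (\<And>k. (\<Sum>j\<in>UNIV. B $ k $ j * z $ j) = 0) \<Longrightarrow>
      (\<Sum>j\<in>UNIV. w $ j * of_int (z $ j)) = 0"
    and v: "map_matrix real_of_int B *v v = 0"
  shows "w \<bullet> v = 0"
proof (rule ccontr)
  assume nz: "w \<bullet> v \<noteq> 0"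
  define C where "C = (\<Sum>k\<in>UNIV. \<Sum>j\<in>UNIV. \<bar>real_of_int (B $ k $ j)\<bar>)"
  define W where "W = (\<Sum>j\<in>UNIV. \<bar>w $ j\<bar>)"
  \<comment> \<open>The bound by \<open>C\<close> forces an integer of modulus below 1; the one by
    \<open>W\<close> yields the final contradiction.\<close>
  obtain N where N: "real N > max (max 1 C) (W / \<bar>w \<bullet> v\<bar>)" using reals_Archimedean2 by blast
  then have "N > 0" by (cases N) auto
  obtain h where h: "bij_betw h {0..<CARD('n)} (UNIV :: 'n set)"
    using ex_bij_betw_nat_finite[OF finite] by blast
  obtain q p where "0 < q" and
    p: "\<And>i. i < CARD('n) \<Longrightarrow> \<bar>of_int q * v $ h i - of_int (p i)\<bar> < 1 / N"
    using Dirichlet_approx_simult[OF \<open>N > 0\<close>, of "CARD('n)" "\<lambda>i. v $ h i"] by metis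
  define z :: "int ^ 'n" where "z = (\<chi> j. p (inv_into {0..<CARD('n)} h j))"
  define e where "e j = of_int q * v $ j - of_int (z $ j)" for j
  have e: "\<bar>e j\<bar> < 1 / N" for j
  proof -
    have "j \<in> h ` {0..<CARD('n)}" using h by (simp add: bij_betw_def)
    then show ?thesis
      using p[of "inv_into {0..<CARD('n)} h j"] inv_into_into[of j h "{0..<CARD('n)}"]
      by (simp add: f_inv_into_f e_def z_def)
  qed
  have small: "\<bar>\<Sum>j\<in>UNIV. a j * e j\<bar> \<le> (\<Sum>j\<in>UNIV. \<bar>a j\<bar>) / N" for a :: "'n \<Rightarrow> real"
  proof -
    have "\<bar>\<Sum>j\<in>UNIV. a j * e j\<bar> \<le> (\<Sum>j\<in>UNIV. \<bar>a j * e j\<bar>)" by (rule sum_abs)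
    also have "\<dots> \<le> (\<Sum>j\<in>UNIV. \<bar>a j\<bar> * (1 / N))"
      unfolding abs_mult using e by (intro sum_mono mult_left_mono) (auto intro: less_imp_le)
    finally show ?thesis by (simp add: sum_divide_distrib)
  qed
  have "(\<Sum>j\<in>UNIV. B $ k $ j * z $ j) = 0" for k
  proof -
    have "(\<Sum>j\<in>UNIV. real_of_int (B $ k $ j) * v $ j) = 0"
      using v by (simp add: vec_eq_iff matrix_vector_mult_def map_matrix_def)
    then have "(\<Sum>j\<in>UNIV. of_int q * (real_of_int (B $ k $ j) * v $ j)) = 0"
      by (simp flip: sum_distrib_left)
    then have "real_of_int (\<Sum>j\<in>UNIV. B $ k $ j * z $ j) = - (\<Sum>j\<in>UNIV. of_int (B $ k $ j) * e j)"
      by (simp add: e_def algebra_simps sum_subtractf)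
    then have "\<bar>real_of_int (\<Sum>j\<in>UNIV. B $ k $ j * z $ j)\<bar> \<le> (\<Sum>j\<in>UNIV. \<bar>real_of_int (B $ k $ j)\<bar>) / N"
      using small[of "\<lambda>j. of_int (B $ k $ j)"] by simp
    also have "(\<Sum>j\<in>UNIV. \<bar>real_of_int (B $ k $ j)\<bar>) \<le> C"
      unfolding C_def by (rule member_le_sum[where f = "\<lambda>k. \<Sum>j\<in>UNIV. \<bar>real_of_int (B $ k $ j)\<bar>"])
        (auto intro: sum_nonneg)
    also have "C / N < 1" using N by simp
    finally have "\<bar>real_of_int (\<Sum>j\<in>UNIV. B $ k $ j * z $ j)\<bar> < 1"
      using \<open>N > 0\<close> by (simp only: divide_right_mono of_nat_0_le_iff)
    then show ?thesis by linarith
  qed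
  then have "(\<Sum>j\<in>UNIV. w $ j * of_int (z $ j)) = 0" by (rule w)
  \<comment> \<open>As \<open>z\<close> is orthogonal to \<open>w\<close>, only the small error
    \<open>e\<close> contributes, whereas \<open>q \<ge> 1\<close> keeps the left side at least
    \<open>\<bar>w \<bullet> v\<bar>\<close> in modulus.\<close>
  then have "of_int q * (w \<bullet> v) = (\<Sum>j\<in>UNIV. w $ j * e j)"
    by (simp add: e_def inner_vec_def algebra_simps sum_subtractf sum_distrib_left)
  then have "\<bar>of_int q * (w \<bullet> v)\<bar> \<le> W / N"
    using small[of "\<lambda>j. w $ j"] by (simp add: W_def)
  then have "of_int q * \<bar>w \<bullet> v\<bar> \<le> W / N"
    using \<open>0 < q\<close> by (simp add: abs_mult)
  moreover have "1 * \<bar>w \<bullet> v\<bar> \<le> of_int q * \<bar>w \<bullet> v\<bar>"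
    using \<open>0 < q\<close> by (intro mult_right_mono) auto
  ultimately have "\<bar>w \<bullet> v\<bar> \<le> W / N" by linarith
  then have "\<bar>w \<bullet> v\<bar> * N \<le> W" using \<open>N > 0\<close> by (simp only: pos_le_divide_eq of_nat_0_less_iff)
  moreover have "W / \<bar>w \<bullet> v\<bar> < N" using N by simp
  then have "W < \<bar>w \<bullet> v\<bar> * N" using nz by (simp add: pos_divide_less_eq mult.commute)
  ultimately show False by linarith
qed

text \<open>The component \<open>k\<close> of \<open>w\<close> orthogonal to the row space lies in
  the real kernel, so \<open>w\<close> is orthogonal to it; therefore \<open>k\<close> is orthogonal
  to itself.\<close>

lemma orthogonal_integer_kernel_row_space:
  fixes B :: "int ^ 'n ^ 'k" and w :: "real ^ 'n"
  assumes w: "\<And>z :: int ^ 'n. (\<And>k. (\<Sum>j\<in>UNIV. B $ k $ j * z $ j) = 0) \<Longrightarrow>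
      (\<Sum>j\<in>UNIV. w $ j * of_int (z $ j)) = 0"
  obtains y where "w = transpose (map_matrix real_of_int B) *v y"
proof -
  define M where "M = map_matrix real_of_int B"
  have "subspace (range ((*v) (transpose M)))"
    by (rule linear_subspace_image) auto
  then obtain r k where r: "r \<in> range ((*v) (transpose M))" and
      k: "\<And>x. x \<in> range ((*v) (transpose M)) \<Longrightarrow> orthogonal k x" and sum: "w = r + k"
    using orthogonal_subspace_decomp_exists[of "range ((*v) (transpose M))" w]
    by (metis span_eq_iff)
  have "(M *v k) \<bullet> (M *v k) = k \<bullet> (transpose M *v (M *v k))"
    using dot_lmul_matrix[of "M *v k" M k] by (simp add: inner_commute)
  also have "\<dots> = 0" using k by (simp add: orthogonal_def)
  finally have "map_matrix real_of_int B *v k = 0" by (simp add: M_def)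
  with w have "w \<bullet> k = 0" by (rule integer_kernel_dense)
  moreover have "r \<bullet> k = 0" using k[OF r] by (simp add: orthogonal_def inner_commute)
  ultimately have "k = 0" by (simp add: sum inner_add_left)
  moreover obtain y where "r = transpose M *v y" using r by blast
  ultimately show ?thesis using that[of y] sum by (simp only: M_def add_0_right)
qed

section \<open>Positive points of the toric cone\<close>

lemma complex_polynomial_prod:
  assumes "\<And>j. j \<in> S \<Longrightarrow> complex_polynomial (f j)"
  shows "complex_polynomial (\<lambda>x. \<Prod>j\<in>S. f j x)"
  using assms
  by (induction S rule: infinite_finite_induct) (auto intro: complex_polynomial.intros)

lemma complex_polynomial_power:
  "complex_polynomial f \<Longrightarrow> complex_polynomial (\<lambda>x. f x ^ k)"
  by (induction k) (auto intro: complex_polynomial.intros)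

lemma complex_polynomial_diff:
  assumes "complex_polynomial f" "complex_polynomial g"
  shows "complex_polynomial (\<lambda>x. f x - g x)"
  using complex_polynomial.add[OF assms(1) complex_polynomial.mult[OF complex_polynomial.const[of "-1"] assms(2)]]
  by simp

lemma complex_polynomial_differentiable:
  "complex_polynomial f \<Longrightarrow> f differentiable (at x)"
proof (induction rule: complex_polynomial.induct)
  case (coord i)
  show ?case by (intro bounded_linear_imp_differentiable bounded_linear_vec_nth)
qed auto

lemma image_subset_toric_cone: "x \<in> torus \<Longrightarrow> psi A c x \<in> toric_cone A c"
  by (auto simp: toric_cone_def zariski_closure_def vanishing_ideal_def)

text \<open>
  The binomials given by the integer kernel of the augmented matrix vanish on the cone, so the
  logarithm of a positive point is orthogonal to that kernel.
\<close>

lemma positive_toric_cone_point: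
  fixes A :: "int ^ 'n ^ 'm" and c p :: "real ^ 'n"
  assumes c: "\<And>j. c $ j > 0" and p: "\<And>j. p $ j > 0"
    and cone: "complex_vec p \<in> toric_cone A (complex_vec c)"
  obtains y where "\<And>j. p $ j = c $ j * exp (exponent_form A j y)"
proof -
  define w :: "real ^ 'n" where "w = (\<chi> j. ln (p $ j / c $ j))"
  have pw: "p $ j = c $ j * exp (w $ j)" for j
    using c[of j] p[of j] by (simp add: w_def)
  have "(\<Sum>j\<in>UNIV. w $ j * of_int (z $ j)) = 0"
    if z: "\<And>k. (\<Sum>j\<in>UNIV. append_ones_row A $ k $ j * z $ j) = 0" for z :: "int ^ 'n"
  proof -
    \<comment> \<open>The binomial of the kernel vector \<open>z\<close>: splitting \<open>z\<close>
      into positive and negative parts keeps the exponents natural, and dividing by \<open>c\<close>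
      removes the scaling.\<close>
    define f :: "complex ^ 'n \<Rightarrow> complex" where
      "f x = (\<Prod>j\<in>UNIV. (inverse (of_real (c $ j)) * x $ j) ^ nat (z $ j)) -
             (\<Prod>j\<in>UNIV. (inverse (of_real (c $ j)) * x $ j) ^ nat (- z $ j))" for x
    have fexp: "f x = exp (\<Sum>j\<in>UNIV. of_nat (nat (z $ j)) * v j) - exp (\<Sum>j\<in>UNIV. of_nat (nat (- z $ j)) * v j)"
      if "\<And>j. x $ j = of_real (c $ j) * exp (v j)" for x v
      using c by (simp add: f_def that exp_sum exp_of_nat_mult less_imp_neq[THEN not_sym] flip: mult.assoc)
    have zsum: "(\<Sum>j\<in>UNIV. of_nat (nat (z $ j)) * v j) - (\<Sum>j\<in>UNIV. of_nat (nat (- z $ j)) * v j) =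
        (\<Sum>j\<in>UNIV. of_int (z $ j) * v j)" for v :: "'n \<Rightarrow> 'a::comm_ring_1"
    proof -
      have "of_nat (nat (z $ j)) - of_nat (nat (- z $ j)) = (of_int (z $ j) :: 'a)" for j
        by (cases "z $ j \<ge> 0") (simp_all add: of_nat_nat)
      then show ?thesis by (simp flip: sum_subtractf left_diff_distrib)
    qed
    have "complex_polynomial f"
      unfolding f_def
      by (intro complex_polynomial_diff complex_polynomial_prod complex_polynomial_power
            complex_polynomial.mult complex_polynomial.const complex_polynomial.coord)
    moreover have "f (psi A (complex_vec c) x) = 0" if torus: "x \<in> torus" for x
    proof -
      obtain y where x: "x = exp_point y" using exp_point_Ln[OF torus, symmetric] by (rule that)
      \<comment> \<open>Orthogonality to the row of ones and to the rows of \<open>A\<close> makes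
        the two monomials agree on the torus.\<close>
      have "(\<Sum>j\<in>UNIV. z $ j) = 0" "(\<Sum>j\<in>UNIV. z $ j * A $ i $ j) = 0" for i
        using z[of None] z[of "Some i"] by (simp_all add: append_ones_row_def mult.commute)
      then have "(\<Sum>j\<in>UNIV. of_int (z $ j)) = (0 :: complex)"
        "(\<Sum>j\<in>UNIV. of_int (z $ j) * of_int (A $ i $ j)) = (0 :: complex)" for i
        by (simp_all flip: of_int_sum of_int_mult)
      then have "(\<Sum>j\<in>UNIV. of_int (z $ j) * exponent_form A j y) = 0"
        by (simp add: sum_mult_exponent_form)
      then have "(\<Sum>j\<in>UNIV. of_nat (nat (z $ j)) * exponent_form A j y) =
          (\<Sum>j\<in>UNIV. of_nat (nat (- z $ j)) * exponent_form A j y)"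
        using zsum[of "\<lambda>j. exponent_form A j y"] by simp
      moreover have "psi A (complex_vec c) x $ j = of_real (c $ j) * exp (exponent_form A j y)" for j
        by (simp add: x psi_exp_point complex_vec_def)
      ultimately show ?thesis by (subst fexp[where v = "\<lambda>j. exponent_form A j y"]) simp_all
    qed
    ultimately have "f (complex_vec p) = 0"
      using cone by (auto simp: toric_cone_def zariski_closure_def vanishing_ideal_def)
    moreover have "complex_vec p $ j = of_real (c $ j) * exp (of_real (w $ j))" for j
      by (simp add: complex_vec_def pw exp_of_real)
    note fexp[of "complex_vec p" "\<lambda>j. of_real (w $ j)", OF this]
    ultimately have "exp (complex_of_real (\<Sum>j\<in>UNIV. of_nat (nat (z $ j)) * w $ j)) =
        exp (complex_of_real (\<Sum>j\<in>UNIV. of_nat (nat (- z $ j)) * w $ j))"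
      by simp
    \<comment> \<open>Both exponents are real, so no multiple of \<open>2 * pi * \<i>\<close>
      intervenes.\<close>
    then have "(\<Sum>j\<in>UNIV. of_nat (nat (z $ j)) * w $ j) = (\<Sum>j\<in>UNIV. of_nat (nat (- z $ j)) * w $ j)"
      by (simp only: exp_of_real of_real_eq_iff exp_inj_iff)
    then show ?thesis using zsum[of "\<lambda>j. w $ j"] by (simp add: mult.commute)
  qed
  \<comment> \<open>The logarithm of \<open>p / c\<close> lies in the row space; the coefficients
    are the logarithms of the parameters.\<close>
  then obtain v where "w = transpose (map_matrix real_of_int (append_ones_row A)) *v v"
    by (rule orthogonal_integer_kernel_row_space)
  then have w: "w $ j = exponent_form A j (v $ None, \<chi> i. v $ Some i)" for j
    by (simp only: exponent_form_transpose)
  show ?thesis by (rule that) (rule pw[unfolded w])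
qed

section \<open>First-order conditions at a maximum likelihood estimate\<close>

lemma has_derivative_complex_vec:
  fixes g :: "real \<Rightarrow> 'n::finite \<Rightarrow> real"
  assumes "\<And>j. ((\<lambda>t. g t j) has_real_derivative r' j) (at 0)"
  shows "((\<lambda>t. complex_vec (\<chi> j. g t j)) has_derivative (\<lambda>h. h *\<^sub>R complex_vec (\<chi> j. r' j))) (at 0)"
proof -
  have eq: "complex_vec (\<chi> j. g t j) = (\<Sum>j\<in>UNIV. g t j *\<^sub>R axis j 1)" for t
    by (simp add: complex_vec_def vec_eq_iff axis_def if_distrib scaleR_conv_of_real[where 'a = complex] cong: if_cong)
  have eq': "h *\<^sub>R complex_vec (\<chi> j. r' j) = (\<Sum>j\<in>UNIV. (r' j * h) *\<^sub>R axis j 1)" for h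
    by (simp add: complex_vec_def vec_eq_iff axis_def if_distrib scaleR_conv_of_real[where 'a = complex] mult.commute cong: if_cong)
  show ?thesis unfolding eq eq'
    using assms by (intro has_derivative_sum has_derivative_scaleR_left) (simp add: has_field_derivative_def)
qed

text \<open>One-parameter curves through the estimate stay in the cone, so their velocities are
  tangent and the likelihood is stationary along them. The logarithmic derivative gives the critical
  equation.\<close>

lemma ml_estimate_critical:
  fixes A :: "int ^ 'n ^ 'm" and c p u :: "real ^ 'n"
  assumes c: "\<And>j. c $ j > 0" and u: "(\<Sum>j\<in>UNIV. u $ j) \<noteq> 0"
    and ml: "is_ml_estimate A (complex_vec c) u p"
  obtains y where "\<And>j. p $ j = c $ j * exp (exponent_form A j y)"
    "exp_critical (exponent_form A) (\<lambda>j. u $ j / (\<Sum>j\<in>UNIV. u $ j)) (\<lambda>j. c $ j) y"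
proof -
  define U where "U = (\<Sum>j\<in>UNIV. u $ j)"
  have p: "\<And>j. p $ j > 0" and sum_p: "(\<Sum>j\<in>UNIV. p $ j) = 1"
    and crit: "critical_point_on (toric_cone A (complex_vec c)) (likelihood u) (complex_vec p)"
    using ml by (auto simp: is_ml_estimate_def)
  obtain y where y: "\<And>j. p $ j = c $ j * exp (exponent_form A j y)"
    using positive_toric_cone_point[OF c p] crit unfolding critical_point_on_def by blast
  have "(\<Sum>j\<in>UNIV. (c $ j * exp (exponent_form A j y) - u $ j / U) * exponent_form A j y') = 0" for y'
  proof -
    define a where "a j = exponent_form A j y'" for j
    define g where "g t j = p $ j * exp (t * a j)" for t j
    define G where "G t = complex_vec (\<chi> j. g t j)" for t
    define v where "v = complex_vec (\<chi> j. p $ j * a j)"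
    have G0: "G 0 = complex_vec p" by (simp add: G_def g_def)
    have gpos: "g t j > 0" for t j using p by (simp add: g_def)
    have dg: "((\<lambda>t. g t j) has_real_derivative p $ j * a j) (at 0)" for j
      unfolding g_def by (auto intro!: derivative_eq_intros)
    have dG: "(G has_derivative (\<lambda>h. h *\<^sub>R v)) (at 0)"
      unfolding G_def v_def by (rule has_derivative_complex_vec[OF dg])
    \<comment> \<open>The curve is the image of a straight line in logarithmic coordinates, hence
      stays in the cone.\<close>
    have image: "G t = psi A (complex_vec c) (exp_point (complex_pair (y + t *\<^sub>R y')))" for t
      by (simp add: G_def g_def a_def y vec_eq_iff psi_exp_point complex_vec_def
          exponent_form_complex_pair linear_add[OF linear_exponent_form]
          linear_cmul[OF linear_exponent_form] exp_add flip: exp_of_real)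
    have chain: "((\<lambda>t. f (G t)) has_derivative (\<lambda>h. frechet_derivative f (at (complex_vec p)) (h *\<^sub>R v))) (at 0)"
      if "f differentiable (at (complex_vec p))" for f :: "complex ^ 'n \<Rightarrow> complex"
      using diff_chain_at[OF dG, of f "frechet_derivative f (at (complex_vec p))"] that
      by (simp add: o_def G0 frechet_derivative_works)
    have "v \<in> tangent_space (toric_cone A (complex_vec c)) (complex_vec p)"
      unfolding tangent_space_def
    proof (intro CollectI ballI)
      fix f assume f: "f \<in> vanishing_ideal (toric_cone A (complex_vec c))"
      then have "(\<lambda>t. f (G t)) = (\<lambda>t. 0)"
        by (auto simp: vanishing_ideal_def image intro!: image_subset_toric_cone exp_point_in_torus)
      moreover have "f differentiable (at (complex_vec p))"
        using f by (simp add: vanishing_ideal_def complex_polynomial_differentiable)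
      ultimately have "((\<lambda>t. 0) has_derivative (\<lambda>h. frechet_derivative f (at (complex_vec p)) (h *\<^sub>R v))) (at (0::real))"
        using chain[of f] by simp
      from fun_cong[OF has_derivative_unique[OF this has_derivative_const], of 1]
      show "frechet_derivative f (at (complex_vec p)) v = 0" by simp
    qed
    then have D0: "frechet_derivative (likelihood u) (at (complex_vec p)) v = 0"
      and diff: "likelihood u differentiable (at (complex_vec p))"
      using crit by (auto simp: critical_point_on_def)
    \<comment> \<open>The likelihood along the curve in real form: the coordinates stay positive, so
      the principal branch is the real power.\<close>
    define \<phi> where "\<phi> t = exp ((\<Sum>j\<in>UNIV. u $ j * (ln (p $ j) + t * a j)) - U * ln (\<Sum>j\<in>UNIV. g t j))" for t
    have gsum: "(\<Sum>j\<in>UNIV. g t j) > 0" for t using gpos by (intro sum_pos) auto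
    have "likelihood u (G t) = of_real (\<phi> t)" for t
    proof -
      have 1: "(\<Sum>j\<in>UNIV. complex_of_real (g t j)) powr of_real U = of_real (exp (U * ln (\<Sum>j\<in>UNIV. g t j)))"
        using powr_of_real[of "\<Sum>j\<in>UNIV. g t j" U] gsum[of t] by (simp add: powr_def)
      have "complex_of_real (g t j) powr of_real (u $ j) = of_real (exp (u $ j * (ln (p $ j) + t * a j)))" for j
        using gpos[of t j] p[of j] powr_of_real[of "g t j" "u $ j"]
        by (simp add: powr_def[of "g t j"]) (simp add: g_def ln_mult)
      then have 2: "(\<Prod>j\<in>UNIV. complex_of_real (g t j) powr of_real (u $ j)) =
          of_real (exp (\<Sum>j\<in>UNIV. u $ j * (ln (p $ j) + t * a j)))"
        by (simp add: exp_sum)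
      show ?thesis
        unfolding likelihood_def U_def[symmetric] G_def complex_vec_def vec_lambda_beta 1 2 \<phi>_def
        by (simp add: exp_diff)
    qed
    then have d1: "((\<lambda>t. complex_of_real (\<phi> t)) has_derivative
        (\<lambda>h. frechet_derivative (likelihood u) (at (complex_vec p)) (h *\<^sub>R v))) (at 0)"
      using chain[OF diff] by simp
    define S where "S t = (\<Sum>j\<in>UNIV. g t j)" for t
    have "(S has_real_derivative (\<Sum>j\<in>UNIV. p $ j * a j)) (at 0)"
      unfolding S_def by (intro DERIV_sum dg)
    \<comment> \<open>With this normalisation \<open>ln (S t)\<close> and \<open>S t\<close> have
      the same derivative at 0.\<close>
    moreover have "S 0 = 1" by (simp add: S_def g_def sum_p)
    ultimately have "(\<phi> has_real_derivative
        \<phi> 0 * ((\<Sum>j\<in>UNIV. u $ j * a j) - U * (\<Sum>j\<in>UNIV. p $ j * a j))) (at 0)"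
      unfolding \<phi>_def S_def[symmetric]
      by (auto intro!: derivative_eq_intros simp: mult.commute)
    then have "((\<lambda>t. complex_of_real (\<phi> t)) has_derivative
        (\<lambda>h. of_real (\<phi> 0 * ((\<Sum>j\<in>UNIV. u $ j * a j) - U * (\<Sum>j\<in>UNIV. p $ j * a j)) * h))) (at 0)"
      unfolding has_field_derivative_def by (rule has_derivative_of_real)
    from fun_cong[OF has_derivative_unique[OF this d1], of 1]
    have "\<phi> 0 * ((\<Sum>j\<in>UNIV. u $ j * a j) - U * (\<Sum>j\<in>UNIV. p $ j * a j)) = 0"
      by (simp only: scaleR_one mult_1_right D0 of_real_eq_0_iff)
    then have "(\<Sum>j\<in>UNIV. u $ j * a j) = U * (\<Sum>j\<in>UNIV. p $ j * a j)"
      by (simp add: \<phi>_def)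
    then have "(\<Sum>j\<in>UNIV. p $ j * a j) = (\<Sum>j\<in>UNIV. u $ j * a j) / U"
      using u by (simp add: U_def)
    also have "\<dots> = (\<Sum>j\<in>UNIV. u $ j / U * a j)" by (simp add: sum_divide_distrib)
    finally show ?thesis by (simp add: y a_def left_diff_distrib sum_subtractf)
  qed
  then have "exp_critical (exponent_form A) (\<lambda>j. u $ j / U) (\<lambda>j. c $ j) y"
    by (simp only: exp_critical_def simp_thms)
  then show ?thesis unfolding U_def using y by (intro that)
qed

section \<open>Paths of the homotopy\<close>

text \<open>The critical equation knows only real directions; it extends to complex ones through its
  coefficients, which are real.\<close>

lemma exp_critical_imp_solution:
  fixes A :: "int ^ 'n ^ 'm"
  assumes u: "(\<Sum>j\<in>UNIV. u $ j) \<noteq> 0"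
    and "exp_critical (exponent_form A) (\<lambda>j. u $ j / (\<Sum>j\<in>UNIV. u $ j)) (\<lambda>j. c $ j) y"
  shows "likelihood_system A (complex_vec c) u (exp_point (complex_pair y)) = 0"
proof -
  define r where "r j = c $ j * exp (exponent_form A j y) - u $ j / (\<Sum>j\<in>UNIV. u $ j)" for j
  have "\<forall>y' :: real \<times> (real ^ 'm). (\<Sum>j\<in>UNIV. r j * exponent_form A j y') = 0"
    using assms(2) by (simp add: exp_critical_def r_def)
  then have "(\<Sum>j\<in>UNIV. r j) = 0" "(\<Sum>j\<in>UNIV. r j * of_int (A $ i $ j)) = 0" for i
    unfolding exponent_form_orthogonal_iff by blast+
  then have "complex_of_real (\<Sum>j\<in>UNIV. r j) = 0"
    "complex_of_real (\<Sum>j\<in>UNIV. r j * of_int (A $ i $ j)) = 0" for i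
    by simp_all
  then have "\<forall>y' :: 'm param. (\<Sum>j\<in>UNIV. of_real (r j) * exponent_form A j y') = 0"
    unfolding exponent_form_orthogonal_iff by simp
  moreover have "psi A (complex_vec c) (exp_point (complex_pair y)) $ j -
      of_real (u $ j / (\<Sum>j\<in>UNIV. u $ j)) = of_real (r j)" for j
    by (simp add: psi_exp_point exponent_form_complex_pair r_def complex_vec_def exp_of_real)
  ultimately show ?thesis
    unfolding likelihood_system_eq_0_iff[OF exp_point_in_torus u] by simp
qed

text \<open>The difference of the \<open>psi\<close> points of two solutions is orthogonal to all
  forms. Testing it with the conjugate of the logarithmic displacement \<open>V\<close> makes every
  form vanish on \<open>V\<close>.\<close>

lemma positive_solution_isolated:
  fixes A :: "int ^ 'n ^ 'm" and c u :: "real ^ 'n"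
  assumes rank: "rank (map_matrix real_of_int (append_ones_row A)) = CARD('m) + 1"
    and c: "\<And>j. c $ j > 0" and u: "(\<Sum>j\<in>UNIV. u $ j) \<noteq> 0"
    and y: "x = exp_point (complex_pair y)" "likelihood_system A (complex_vec c) u x = 0"
    and z: "z \<in> torus" "likelihood_system A (complex_vec c) u z = 0"
    and near: "\<And>j. norm (exponent_form A j
      (Ln (fst z / fst x), \<chi> i. Ln (snd z $ i / snd x $ i))) < 1/4"
  shows "z = x"
proof -
  define V where "V = (Ln (fst z / fst x), \<chi> i. Ln (snd z $ i / snd x $ i))"
  define W where "W j = exponent_form A j V" for j
  define p where "p j = c $ j * exp (exponent_form A j y)" for j
  have x: "x \<in> torus" by (simp add: y exp_point_in_torus)
  have zV: "z = exp_point (complex_pair y + V)"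
    using z(1) by (auto simp: V_def y exp_point_def torus_def exp_add vec_eq_iff)
  have psi_x: "psi A (complex_vec c) x $ j = of_real (p j)" for j
    by (simp add: y psi_exp_point exponent_form_complex_pair p_def complex_vec_def exp_of_real)
  have psi_z: "psi A (complex_vec c) z $ j = of_real (p j) * exp (W j)" for j
    by (simp add: zV psi_exp_point exponent_form_add exponent_form_complex_pair p_def W_def
        complex_vec_def exp_of_real exp_add)
  \<comment> \<open>Conjugation passes through forms with integer coefficients, so this direction
    produces \<open>cnj (W j)\<close>.\<close>
  define V' where "V' = (cnj (fst V), \<chi> i. cnj (snd V $ i))"
  have "(\<Sum>j\<in>UNIV. (psi A (complex_vec c) z $ j - psi A (complex_vec c) x $ j) * exponent_form A j V') =
      (\<Sum>j\<in>UNIV. (psi A (complex_vec c) z $ j - of_real (u $ j / (\<Sum>j\<in>UNIV. u $ j))) * exponent_form A j V') -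
      (\<Sum>j\<in>UNIV. (psi A (complex_vec c) x $ j - of_real (u $ j / (\<Sum>j\<in>UNIV. u $ j))) * exponent_form A j V')"
    by (simp only: sum_subtractf[symmetric] left_diff_distrib[symmetric] diff_diff_eq2 diff_add_cancel)
  also have "\<dots> = 0"
    using y(2) z(2) unfolding likelihood_system_eq_0_iff[OF x u] likelihood_system_eq_0_iff[OF z(1) u]
    by (simp only: diff_self)
  finally have "(\<Sum>j\<in>UNIV. of_real (p j) * (exp (W j) - 1) * cnj (W j)) = 0"
    unfolding psi_x psi_z V'_def exponent_form_cnj[symmetric] W_def[symmetric]
    by (simp add: algebra_simps)
  moreover have "p j > 0" for j by (simp add: p_def c)
  ultimately have "W j = 0" for j
    using near complex_exp_pairing_eq_0[of p W] by (simp add: W_def V_def)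
  then have "V = 0"
    using complex_exponent_form_separating[OF rank] by (simp add: W_def)
  then show ?thesis by (simp add: zV y)
qed

lemma correspondsE:
  fixes A :: "int ^ 'n ^ 'm"
  assumes "corresponds A (complex_vec c) x p"
  obtains y where "x = exp_point (complex_pair y)" "\<And>j. p $ j = c $ j * exp (exponent_form A j y)"
proof -
  obtain s \<theta> where s: "s > 0" "\<And>i. \<theta> $ i > 0" "x = (of_real s, complex_vec \<theta>)"
    and psi: "psi A (complex_vec c) x = complex_vec p"
    using assms by (auto simp: corresponds_def)
  define y where "y = (ln s, \<chi> i. ln (\<theta> $ i))"
  have x: "x = exp_point (complex_pair y)"
    using s by (simp add: y_def exp_point_def complex_pair_def complex_vec_def vec_eq_iff exp_of_real)
  have "complex_of_real (p $ j) = of_real (c $ j * exp (exponent_form A j y))" for j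
    using arg_cong[OF psi, of "\<lambda>v. v $ j"]
    by (simp add: x psi_exp_point exponent_form_complex_pair complex_vec_def exp_of_real)
  then have "p $ j = c $ j * exp (exponent_form A j y)" for j
    by (simp only: of_real_eq_iff)
  with x show ?thesis by (rule that)
qed

lemma correspondsI:
  fixes A :: "int ^ 'n ^ 'm"
  assumes "\<And>j. p $ j = c $ j * exp (exponent_form A j y)"
  shows "corresponds A (complex_vec c) (exp_point (complex_pair y)) p"
  unfolding corresponds_def
proof (intro conjI exI)
  show "exp_point (complex_pair y) = (of_real (exp (fst y)), complex_vec (\<chi> i. exp (snd y $ i)))"
    by (simp add: exp_point_def complex_pair_def complex_vec_def vec_eq_iff exp_of_real)
  show "psi A (complex_vec c) (exp_point (complex_pair y)) = complex_vec p"
    by (simp add: vec_eq_iff psi_exp_point exponent_form_complex_pair complex_vec_def exp_of_real assms)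
qed auto

lemma convex_combination_pos:
  fixes c c' :: "real ^ 'n"
  assumes "t \<in> {0..1}" "c $ j > 0" "c' $ j > 0"
  shows "(t *\<^sub>R c + (1 - t) *\<^sub>R c') $ j > 0"
proof (cases "t = 0")
  case False
  then have "t * c $ j > 0" "(1 - t) * c' $ j \<ge> 0" using assms by auto
  then show ?thesis by simp
qed (use assms in simp)

text \<open>Agreement of the paths is closed by continuity and open by isolation, and the interval
  is connected. Positivity is assumed of \<open>\<gamma>\<close>; \<open>\<delta>\<close> may run
  through complex points of the torus.\<close>

lemma homotopy_path_unique:
  fixes A :: "int ^ 'n ^ 'm" and c c' u :: "real ^ 'n"
  assumes rank: "rank (map_matrix real_of_int (append_ones_row A)) = CARD('m) + 1"
    and c: "\<And>j. c $ j > 0" "\<And>j. c' $ j > 0" and u: "(\<Sum>j\<in>UNIV. u $ j) \<noteq> 0"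
    and \<gamma>: "is_homotopy_path A (complex_vec c) (complex_vec c') u \<gamma>"
      "\<And>t. t \<in> {0..1} \<Longrightarrow> \<gamma> t \<in> range (\<lambda>y. exp_point (complex_pair y))"
    and \<delta>: "is_homotopy_path A (complex_vec c) (complex_vec c') u \<delta>"
    and start: "\<delta> 1 = \<gamma> 1" and t: "t \<in> {0..1}"
  shows "\<delta> t = \<gamma> t"
proof -
  define E where "E = {t \<in> {0..1}. \<delta> t = \<gamma> t}"
  have cont: "continuous_on {0..1} \<gamma>" "continuous_on {0..1} \<delta>"
    and torus: "\<And>t. t \<in> {0..1} \<Longrightarrow> \<gamma> t \<in> torus" "\<And>t. t \<in> {0..1} \<Longrightarrow> \<delta> t \<in> torus"
    using \<gamma>(1) \<delta> by (auto simp: is_homotopy_path_def)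
  have solution: "likelihood_system A (complex_vec (t *\<^sub>R c + (1 - t) *\<^sub>R c')) u (\<gamma> t) = 0"
    "likelihood_system A (complex_vec (t *\<^sub>R c + (1 - t) *\<^sub>R c')) u (\<delta> t) = 0" if "t \<in> {0..1}" for t
    unfolding homotopy_system_torus[OF torus(1)[OF that], symmetric]
      homotopy_system_torus[OF torus(2)[OF that], symmetric]
    using \<gamma>(1) \<delta> that by (auto simp: is_homotopy_path_def)
  have pos: "(t *\<^sub>R c + (1 - t) *\<^sub>R c') $ j > 0" if "t \<in> {0..1}" for t j
    using that c by (rule convex_combination_pos)
  have "openin (top_of_set {0..1}) E"
    unfolding openin_euclidean_subtopology_iff
  proof (intro conjI ballI)
    fix s assume "s \<in> E"
    then have s: "s \<in> {0..1}" "\<delta> s = \<gamma> s" by (auto simp: E_def)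
    \<comment> \<open>This logarithmic displacement tends to 0 at \<open>s\<close>, so near
      \<open>s\<close> all its forms are below the isolation radius 1/4.\<close>
    define V where "V t = (Ln (fst (\<delta> t) / fst (\<gamma> t)), \<chi> i. Ln (snd (\<delta> t) $ i / snd (\<gamma> t) $ i))" for t
    have lim: "(\<gamma> \<longlongrightarrow> \<gamma> s) (at s within {0..1})" "(\<delta> \<longlongrightarrow> \<gamma> s) (at s within {0..1})"
      using bspec[OF cont(1)[unfolded continuous_on] s(1)]
        bspec[OF cont(2)[unfolded continuous_on] s(1)] by (simp_all only: s(2))
    have nz: "fst (\<gamma> s) \<noteq> 0" "snd (\<gamma> s) $ i \<noteq> 0" for i
      using torus(1)[OF s(1)] by (auto simp: torus_def)
    have "((\<lambda>t. fst (\<delta> t) / fst (\<gamma> t)) \<longlongrightarrow> 1) (at s within {0..1})"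
      using tendsto_divide[OF tendsto_fst[OF lim(2)] tendsto_fst[OF lim(1)]] nz by simp
    from tendsto_Ln[OF this]
    have 1: "((\<lambda>t. fst (V t)) \<longlongrightarrow> 0) (at s within {0..1})" by (simp add: V_def)
    have "((\<lambda>t. snd (\<delta> t) $ i / snd (\<gamma> t) $ i) \<longlongrightarrow> 1) (at s within {0..1})" for i
      using tendsto_divide[OF tendsto_vec_nth[OF tendsto_snd[OF lim(2)]]
          tendsto_vec_nth[OF tendsto_snd[OF lim(1)]], of i i] nz by simp
    from tendsto_Ln[OF this]
    have 2: "((\<lambda>t. snd (V t) $ i) \<longlongrightarrow> 0) (at s within {0..1})" for i by (simp add: V_def)
    have "((\<lambda>t. exponent_form A j (V t)) \<longlongrightarrow> 0 + (\<Sum>i\<in>UNIV. of_int (A $ i $ j) * 0)) (at s within {0..1})" for j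
      unfolding exponent_form_def by (intro tendsto_intros 1 2)
    then have "((\<lambda>t. norm (exponent_form A j (V t))) \<longlongrightarrow> 0) (at s within {0..1})" for j
      by (simp add: tendsto_norm_zero_iff)
    then have "\<forall>\<^sub>F t in at s within {0..1}. norm (exponent_form A j (V t)) < 1/4" for j
      by (rule order_tendstoD) simp
    then have "\<forall>\<^sub>F t in at s within {0..1}. \<forall>j. norm (exponent_form A j (V t)) < 1/4"
      by (rule eventually_all_finite)
    then obtain d where d: "d > 0" "\<And>t j. t \<in> {0..1} \<Longrightarrow> t \<noteq> s \<Longrightarrow> dist t s < d \<Longrightarrow>
        norm (exponent_form A j (V t)) < 1/4"
      unfolding eventually_at by blast
    have "t \<in> E" if t: "t \<in> {0..1}" "dist t s < d" for t
    proof (cases "t = s")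
      case False
      obtain y where y: "\<gamma> t = exp_point (complex_pair y)" using \<gamma>(2)[OF t(1)] by blast
      have "\<delta> t = \<gamma> t"
        by (rule positive_solution_isolated[OF rank pos[OF t(1)] u y solution(1)[OF t(1)]
              torus(2)[OF t(1)] solution(2)[OF t(1)] d(2)[OF t(1) False t(2), unfolded V_def]])
      then show ?thesis using t by (simp add: E_def)
    qed (use \<open>s \<in> E\<close> in simp)
    then show "\<exists>d>0. \<forall>t\<in>{0..1}. dist t s < d \<longrightarrow> t \<in> E" using d(1) by blast
  qed (auto simp: E_def)
  moreover have "closedin (top_of_set {0..1}) E"
  proof -
    have "E = {t \<in> {0..1}. \<delta> t - \<gamma> t = 0}" by (auto simp: E_def)
    then show ?thesis
      using continuous_closedin_preimage_constant[OF continuous_on_diff[OF cont(2,1)], of 0] by simp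
  qed
  moreover have "1 \<in> E" using start by (simp add: E_def)
  ultimately have "E = {0..1}"
    using connected_Icc[of 0 "1::real", unfolded connected_clopen, THEN spec, of E] by fast
  with t have "t \<in> E" by (simp only:)
  then show ?thesis by (simp add: E_def)
qed

theorem theorem38:
  fixes A :: "int ^ 'n ^ 'm" and c_easy c_stat :: "real ^ 'n"
  assumes "rank (map_matrix real_of_int A) = CARD('m)"
    and "rank (map_matrix real_of_int (append_ones_row A)) = CARD('m) + 1"
    and "\<And>j. c_easy $ j > 0" and "\<And>j. c_stat $ j > 0"
  shows "holds_generically (\<lambda>u. (\<forall>j. u $ j > 0) \<longrightarrow>
    (\<forall>p_easy p_stat.
      is_ml_estimate A (complex_vec c_easy) u p_easy \<and>
      is_ml_estimate A (complex_vec c_stat) u p_stat \<longrightarrow>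
      (\<exists>\<gamma>. is_homotopy_path A (complex_vec c_easy) (complex_vec c_stat) u \<gamma> \<and>
           corresponds A (complex_vec c_easy) (\<gamma> 1) p_easy \<and>
           (\<forall>\<delta>. is_homotopy_path A (complex_vec c_easy) (complex_vec c_stat) u \<delta> \<and>
                corresponds A (complex_vec c_easy) (\<delta> 1) p_easy \<longrightarrow>
                (\<forall>t\<in>{0..1}. \<delta> t = \<gamma> t)) \<and>
           corresponds A (complex_vec c_stat) (\<gamma> 0) p_stat)))"
  unfolding holds_generically_def
\<comment> \<open>The constant 1 is a polynomial without zeros, so the claim remains for arbitrary
  positive \<open>u\<close>.\<close>
proof (intro exI[of _ "\<lambda>_. 1"] conjI allI impI)
  show "real_polynomial_function (\<lambda>_ :: real ^ 'n. 1)" by (rule real_polynomial_function.intros)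
next
  fix u p_easy p_stat :: "real ^ 'n"
  assume u_pos: "\<forall>j. u $ j > 0" and ml: "is_ml_estimate A (complex_vec c_easy) u p_easy \<and>
    is_ml_estimate A (complex_vec c_stat) u p_stat"
  interpret linear_forms "exponent_form A :: 'n \<Rightarrow> real \<times> (real ^ 'm) \<Rightarrow> real"
    by (rule linear_forms_exponent_form) fact
  have U: "(\<Sum>j\<in>UNIV. u $ j) > 0" using u_pos by (intro sum_pos) auto
  then have U0: "(\<Sum>j\<in>UNIV. u $ j) \<noteq> 0" by simp
  define q where "q j = u $ j / (\<Sum>j\<in>UNIV. u $ j)" for j
  have q: "q j > 0" for j using u_pos U by (simp add: q_def)
  define c where "c t = t *\<^sub>R c_easy + (1 - t) *\<^sub>R c_stat" for t
  have c_pos: "c t $ j > 0" if "t \<in> {0..1}" for t j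
    unfolding c_def using that assms(3,4) by (rule convex_combination_pos)
  have c_cont: "continuous_on {0..1} (\<lambda>t. c t $ j)" for j
    unfolding c_def by (intro continuous_intros)
  obtain y where y_cont: "continuous_on {0..1} y"
    and y: "\<And>t. t \<in> {0..1} \<Longrightarrow> exp_critical (exponent_form A) q (\<lambda>j. c t $ j) (y t)"
    by (rule exp_critical_path[of "\<lambda>t j. c t $ j" q, OF c_pos q c_cont]) (assumption, rule that)
  obtain y_easy where y_easy: "\<And>j. p_easy $ j = c_easy $ j * exp (exponent_form A j y_easy)"
    "exp_critical (exponent_form A) q (\<lambda>j. c_easy $ j) y_easy"
    by (rule ml_estimate_critical[OF assms(3) U0 conjunct1[OF ml], folded q_def]) (rule that)
  obtain y_stat where y_stat: "\<And>j. p_stat $ j = c_stat $ j * exp (exponent_form A j y_stat)"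
    "exp_critical (exponent_form A) q (\<lambda>j. c_stat $ j) y_stat"
    by (rule ml_estimate_critical[OF assms(4) U0 conjunct2[OF ml], folded q_def]) (rule that)
  \<comment> \<open>At both ends the path and the estimate give critical points for the same scaling
    and data, which uniqueness identifies.\<close>
  have "c 1 = c_easy" "c 0 = c_stat" by (simp_all add: c_def)
  then have "exp_critical (exponent_form A) q (\<lambda>j. c_easy $ j) (y 1)"
    "exp_critical (exponent_form A) q (\<lambda>j. c_stat $ j) (y 0)"
    using y[of 1] y[of 0] by simp_all
  then have "y 1 = y_easy" "y 0 = y_stat"
    using exp_critical_unique assms(3,4) y_easy(2) y_stat(2) by blast+
  define \<gamma> where "\<gamma> t = exp_point (complex_pair (y t))" for t
  have path: "is_homotopy_path A (complex_vec c_easy) (complex_vec c_stat) u \<gamma>"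
    unfolding is_homotopy_path_def
  proof (intro conjI ballI)
    show "continuous_on {0..1} \<gamma>"
      unfolding \<gamma>_def exp_point_def complex_pair_def complex_vec_def fst_conv snd_conv vec_lambda_beta
      by (intro continuous_intros y_cont)
    fix t :: real assume t: "t \<in> {0..1}"
    show torus: "\<gamma> t \<in> torus" by (simp add: \<gamma>_def exp_point_in_torus)
    show "homotopy_system A (complex_vec c_easy) (complex_vec c_stat) u (\<gamma> t) t = 0"
      unfolding homotopy_system_torus[OF torus] c_def[symmetric] unfolding \<gamma>_def
      by (rule exp_critical_imp_solution[OF U0 y[OF t, unfolded q_def]])
  qed
  have start: "corresponds A (complex_vec c_easy) (\<gamma> 1) p_easy"
    unfolding \<gamma>_def \<open>y 1 = y_easy\<close> by (rule correspondsI[OF y_easy(1)])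
  have finish: "corresponds A (complex_vec c_stat) (\<gamma> 0) p_stat"
    unfolding \<gamma>_def \<open>y 0 = y_stat\<close> by (rule correspondsI[OF y_stat(1)])
  have "\<delta> t = \<gamma> t"
    if \<delta>: "is_homotopy_path A (complex_vec c_easy) (complex_vec c_stat) u \<delta>"
      "corresponds A (complex_vec c_easy) (\<delta> 1) p_easy" and t: "t \<in> {0..1}" for \<delta> t
  proof -
    obtain z where z: "\<delta> 1 = exp_point (complex_pair z)"
      "\<And>j. p_easy $ j = c_easy $ j * exp (exponent_form A j z)"
      by (rule correspondsE[OF \<delta>(2)]) (rule that)
    \<comment> \<open>\<open>p_easy\<close> determines the values of all forms, and these separate
      points, so every competing path starts where \<open>\<gamma>\<close> does.\<close>
    have "exponent_form A j (z - y_easy) = 0" for j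
      using z(2)[of j] y_easy(1)[of j] assms(3)[of j] by (simp add: exponent_form_diff)
    then have "z = y_easy" using separating[of "z - y_easy"] by simp
    then have "\<delta> 1 = \<gamma> 1" by (simp add: z(1) \<gamma>_def \<open>y 1 = y_easy\<close>)
    then show ?thesis
      by (intro homotopy_path_unique[OF assms(2-4) U0 path _ \<delta>(1) _ t]) (simp_all add: \<gamma>_def)
  qed
  then show "\<exists>\<gamma>. is_homotopy_path A (complex_vec c_easy) (complex_vec c_stat) u \<gamma> \<and>
      corresponds A (complex_vec c_easy) (\<gamma> 1) p_easy \<and>
      (\<forall>\<delta>. is_homotopy_path A (complex_vec c_easy) (complex_vec c_stat) u \<delta> \<and>
        corresponds A (complex_vec c_easy) (\<delta> 1) p_easy \<longrightarrow> (\<forall>t\<in>{0..1}. \<delta> t = \<gamma> t)) \<and>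
      corresponds A (complex_vec c_stat) (\<gamma> 0) p_stat"
    using path start finish by blast
qed auto

end
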